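(* Let $(S,R)$ be a positive presentation such that, for every relation $v=v'$ of $R$, we have $\big||v|-|v'|\big|\le 2$. Then, for all $w,w'$ in $\mathcal W(S)$, the relation $w\rightsquigarrow^{0,D}_R w'$ implies $w\rightsquigarrow^{0,1,2}_R w'$.
   Context: For a set $S$, $\mathcal W^+(S)$ is the free monoid of all words in the alphabet $S$, and $\mathcal W(S)$ is the free monoid of all words in $S\sqcup S^{-1}$, where $S^{-1}$ is a disjoint copy of $S$ with one letter $s^{-1}$ for each $s\in S$. The empty word is $\varepsilon$; $|w|$ is the length (number of letters) of a word $w$; for $w\in\mathcal W(S)$, $w^{-1}$ is the word obtained by exchanging $s$ and $s^{-1}$ everywhere and reversing the order of letters. A word $v$ is a factor of $w$ if $w=w_1vw_2$ for some words $w_1,w_2$. A presentation $(S,R)$ is positive if every relation of $R$ is of the form $v=v'$ with $v,v'$ nonempty words of $\mathcal W^+(S)$ (relations are unoriented: $v=v'$ and $v'=v$ are the same relation). Special transformations on words of $\mathcal W(S)$: - type $0$: remove some pair $s^{-1}s$ or $ss^{-1}$ with $s\in S$; - type $1$: replace some factor $v$ by $v'$, or $v^{-1}$ by $v'^{-1}$, where $v=v'$ is a relation of $R$; - type $2_r$: replace some factor $v^{-1}v'$ by $uu'^{-1}$, where $v,v'$ are nonempty words of $\mathcal W^+(S)$ and $vu=v'u'$ is a relation of $R$; - type $2_\ell$: replace some factor $vv'^{-1}$ by $u^{-1}u'$, where $v,v'$ are nonempty words of $\mathcal W^+(S)$ and $uv=u'v'$ is a relation of $R$. Type $2$ means $2_r$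 or $2_\ell$. One writes $w\rightsquigarrow^{0,1,2}_R w'$ if $w$ can be transformed to $w'$ by a finite (possibly empty) sequence of special transformations of types $0$, $1$, $2$. Dehn transformations: $w'$ is obtained from $w$ by a Dehn transformation with respect to $R$ if $w'$ is obtained by replacing some factor $u$ of $w$ with a word $u'\in\mathcal W(S)$ such that $|u|>|u'|$ and there is a relation $v=v'$ of $R$ such that $u^{-1}u'$ is a cyclic permutation of $v^{-1}v'$ or of $v'^{-1}v$. One writes $w\rightsquigarrow^{0,D}_R w'$ if $w'$ is obtained from $w$ by a finite sequence of type $0$ transformations and Dehn transformations with respect to $R$. *)

theory Defs
  imports Main
begin

text \<open>
  The disjoint union of \<open>S\<close> and a copy \<open>S\<inverse>\<close> is the disjoint sum \<open>S <+> S\<close>: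
  \<open>Inl s\<close> is the letter \<open>s\<close> and \<open>Inr s\<close> is the letter \<open>s\<inverse>\<close>.
\<close>

definition pwords :: "'a set \<Rightarrow> 'a list set" where
  "pwords S = lists S"

definition swords :: "'a set \<Rightarrow> ('a + 'a) list set" where
  "swords S = lists (S <+> S)"

definition emb :: "'a list \<Rightarrow> ('a + 'a) list" where
  "emb v = map Inl v"

definition inv_word :: "('a + 'a) list \<Rightarrow> ('a + 'a) list" where
  "inv_word w = rev (map (case_sum Inr Inl) w)"

definition positive_presentation :: "'a set \<Rightarrow> ('a list \<times> 'a list) set \<Rightarrow> bool" where
  "positive_presentation S R \<longleftrightarrow>
     (\<forall>(v, v') \<in> R. v \<in> pwords S \<and> v' \<in> pwords S \<and> v \<noteq> [] \<and> v' \<noteq> [])"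

text \<open>
  Relations are unoriented, whereas \<open>R\<close> is an arbitrary set of ordered pairs: a pair in
  \<open>R\<close>, read in either direction, is a relation.
\<close>

definition is_relation :: "('a list \<times> 'a list) set \<Rightarrow> 'a list \<Rightarrow> 'a list \<Rightarrow> bool" where
  "is_relation R v v' \<longleftrightarrow> (v, v') \<in> R \<or> (v', v) \<in> R"

definition replace_factor ::
  "'a set \<Rightarrow> ('a + 'a) list \<Rightarrow> ('a + 'a) list \<Rightarrow> ('a + 'a) list \<Rightarrow> ('a + 'a) list \<Rightarrow> bool" where
  "replace_factor S u u' w w' \<longleftrightarrow>
     u \<in> swords S \<and> u' \<in> swords S \<and>
     (\<exists>x \<in> swords S. \<exists>y \<in> swords S. w = x @ u @ y \<and> w' = x @ u' @ y)"

definition type0 :: "'a set \<Rightarrow> ('a + 'a) list \<Rightarrow> ('a + 'a) list \<Rightarrow> bool" where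
  "type0 S w w' \<longleftrightarrow>
     (\<exists>s \<in> S. replace_factor S [Inr s, Inl s] [] w w' \<or> replace_factor S [Inl s, Inr s] [] w w')"

definition type1 ::
  "'a set \<Rightarrow> ('a list \<times> 'a list) set \<Rightarrow> ('a + 'a) list \<Rightarrow> ('a + 'a) list \<Rightarrow> bool" where
  "type1 S R w w' \<longleftrightarrow>
     (\<exists>v v'. is_relation R v v' \<and>
        (replace_factor S (emb v) (emb v') w w' \<or>
         replace_factor S (inv_word (emb v)) (inv_word (emb v')) w w'))"

definition type2r ::
  "'a set \<Rightarrow> ('a list \<times> 'a list) set \<Rightarrow> ('a + 'a) list \<Rightarrow> ('a + 'a) list \<Rightarrow> bool" where
  "type2r S R w w' \<longleftrightarrow>
     (\<exists>v \<in> pwords S. \<exists>v' \<in> pwords S. \<exists>u \<in> pwords S. \<exists>u' \<in> pwords S.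
        v \<noteq> [] \<and> v' \<noteq> [] \<and> is_relation R (v @ u) (v' @ u') \<and>
        replace_factor S (inv_word (emb v) @ emb v') (emb u @ inv_word (emb u')) w w')"

definition type2l ::
  "'a set \<Rightarrow> ('a list \<times> 'a list) set \<Rightarrow> ('a + 'a) list \<Rightarrow> ('a + 'a) list \<Rightarrow> bool" where
  "type2l S R w w' \<longleftrightarrow>
     (\<exists>v \<in> pwords S. \<exists>v' \<in> pwords S. \<exists>u \<in> pwords S. \<exists>u' \<in> pwords S.
        v \<noteq> [] \<and> v' \<noteq> [] \<and> is_relation R (u @ v) (u' @ v') \<and>
        replace_factor S (emb v @ inv_word (emb v')) (inv_word (emb u) @ emb u') w w')"

definition special_step ::
  "'a set \<Rightarrow> ('a list \<times> 'a list) set \<Rightarrow> ('a + 'a) list \<Rightarrow> ('a + 'a) list \<Rightarrow> bool" where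
  "special_step S R w w' \<longleftrightarrow>
     type0 S w w' \<or> type1 S R w w' \<or> type2r S R w w' \<or> type2l S R w w'"

definition special_reach ::
  "'a set \<Rightarrow> ('a list \<times> 'a list) set \<Rightarrow> ('a + 'a) list \<Rightarrow> ('a + 'a) list \<Rightarrow> bool" where
  "special_reach S R = (special_step S R)\<^sup>*\<^sup>*"

definition cyclic_perm :: "'b list \<Rightarrow> 'b list \<Rightarrow> bool" where
  "cyclic_perm xs ys \<longleftrightarrow> (\<exists>n. xs = rotate n ys)"

definition dehn_step ::
  "'a set \<Rightarrow> ('a list \<times> 'a list) set \<Rightarrow> ('a + 'a) list \<Rightarrow> ('a + 'a) list \<Rightarrow> bool" where
  "dehn_step S R w w' \<longleftrightarrow>
     (\<exists>u u'. replace_factor S u u' w w' \<and> length u > length u' \<and>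
        (\<exists>v v'. is_relation R v v' \<and>
           (cyclic_perm (inv_word u @ u') (inv_word (emb v) @ emb v') \<or>
            cyclic_perm (inv_word u @ u') (inv_word (emb v') @ emb v))))"

definition dehn_reach ::
  "'a set \<Rightarrow> ('a list \<times> 'a list) set \<Rightarrow> ('a + 'a) list \<Rightarrow> ('a + 'a) list \<Rightarrow> bool" where
  "dehn_reach S R = (\<lambda>w w'. type0 S w w' \<or> dehn_step S R w w')\<^sup>*\<^sup>*"

end

theory Submission imports Defs begin

text \<open>
  Read a relation \<open>p = q\<close> as a circle, labelled \<open>p\<inverse>q\<close>, made of two positive paths \<open>p\<close> and
  \<open>q\<close> with the same source and the same target. A Dehn transformation for this relation
  replaces an arc \<open>u\<close> of the circle by the shorter complementary arc \<open>u'\<close>, so everything depends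
  on whether the source and the target lie inside \<open>u\<close>.

  \<^item> If only the source or only the target is interior to \<open>u\<close>, the replacement is literally a
    transformation of type \<open>2\<^sub>r\<close> or \<open>2\<^sub>\<ell>\<close>.

  \<^item> If both are interior to \<open>u\<close>, then up to inversion and exchange of \<open>p\<close> and \<open>q\<close> we have
    \<open>u = a\<inverse>pb\<inverse>\<close> and \<open>q = au'b\<close>. A type \<open>1\<close> transformation gives \<open>a\<inverse>au'bb\<inverse>\<close>, and this
    freely reduces to \<open>u'\<close>. This is \<open>special_reach_cancel_ends\<close>.

  \<^item> If neither is interior to \<open>u\<close>, then up to the same symmetries \<open>p = aub\<close> and
    \<open>u' = a\<inverse>qb\<inverse>\<close>, so \<open>|u| - |u'| = |p| - |q| - 2(|a| + |b|)\<close>. This is positive and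
    \<open>|p| - |q| \<le> 2\<close>, so \<open>a\<close> and \<open>b\<close> are empty, and the replacement is a
    transformation of type \<open>1\<close>. Only this case uses the hypothesis on lengths.

  These cases are assembled in \<open>special_reach_complementary_arc\<close>.
\<close>

section \<open>Signed words and formal inverses\<close>

lemma inv_word_Nil [simp]: "inv_word [] = []"
  by (simp add: inv_word_def)

lemma inv_word_append [simp]: "inv_word (x @ y) = inv_word y @ inv_word x"
  by (simp add: inv_word_def)

lemma inv_word_inv_word [simp]: "inv_word (inv_word x) = x"
proof -
  have "case_sum Inr Inl (case_sum Inr Inl s) = s" for s :: "'a + 'a"
    by (cases s) auto
  then show ?thesis
    by (simp add: inv_word_def rev_map o_def)
qed

lemma inv_word_eq_iff: "inv_word x = y \<longleftrightarrow> x = inv_word y"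
  by auto

lemma length_inv_word [simp]: "length (inv_word x) = length x"
  by (simp add: inv_word_def)

lemma length_emb [simp]: "length (emb x) = length x"
  by (simp add: emb_def)

lemma emb_append [simp]: "emb (x @ y) = emb x @ emb y"
  by (simp add: emb_def)

lemma emb_Nil [simp]: "emb [] = []"
  by (simp add: emb_def)

lemma emb_eq_append_conv:
  "emb p = x @ y \<longleftrightarrow> (\<exists>a b. p = a @ b \<and> x = emb a \<and> y = emb b)"
  by (auto simp: emb_def map_eq_append_conv)

lemma inv_word_emb_eq_append_conv:
  "inv_word (emb p) = x @ y \<longleftrightarrow>
     (\<exists>a b. p = a @ b \<and> x = inv_word (emb b) \<and> y = inv_word (emb a))"
  by (auto simp: inv_word_eq_iff emb_eq_append_conv)

lemma swords_append [simp]: "x @ y \<in> swords S \<longleftrightarrow> x \<in> swords S \<and> y \<in> swords S"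
  by (auto simp: swords_def)

lemma swords_Nil [simp]: "[] \<in> swords S"
  by (simp add: swords_def)

lemma inv_word_swords [simp]: "inv_word x \<in> swords S \<longleftrightarrow> x \<in> swords S"
proof -
  have "inv_word y \<in> swords S" if "y \<in> swords S" for y
    using that by (force simp: inv_word_def swords_def split: sum.split)
  from this[of x] this[of "inv_word x"] show ?thesis
    by auto
qed

lemma pwords_append [simp]: "x @ y \<in> pwords S \<longleftrightarrow> x \<in> pwords S \<and> y \<in> pwords S"
  by (auto simp: pwords_def)

lemma emb_swords [simp]: "emb x \<in> swords S \<longleftrightarrow> x \<in> pwords S"
  by (auto simp: emb_def swords_def pwords_def)

lemma is_relation_sym: "is_relation R p q \<Longrightarrow> is_relation R q p"
  by (auto simp: is_relation_def)

lemma is_relation_pwords: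
  "positive_presentation S R \<Longrightarrow> is_relation R p q \<Longrightarrow> p \<in> pwords S \<and> q \<in> pwords S"
  by (auto simp: positive_presentation_def is_relation_def)


section \<open>Special transformations inside a word\<close>

lemma replace_factor_context:
  assumes "replace_factor S u u' w w'" "x \<in> swords S" "y \<in> swords S"
  shows "replace_factor S u u' (x @ w @ y) (x @ w' @ y)"
proof -
  obtain a b where "u \<in> swords S" "u' \<in> swords S" "a \<in> swords S" "b \<in> swords S"
    and "w = a @ u @ b" "w' = a @ u' @ b"
    using assms(1) by (auto simp: replace_factor_def)
  then show ?thesis
    unfolding replace_factor_def using assms(2,3)
    by (intro conjI bexI[of _ "x @ a"] bexI[of _ "b @ y"]) auto
qed

lemma replace_factor_self: "u \<in> swords S \<Longrightarrow> u' \<in> swords S \<Longrightarrow> replace_factor S u u' u u'"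
  unfolding replace_factor_def by (intro conjI bexI[of _ "[]"]) auto

lemma special_step_context:
  assumes "special_step S R w w'" "x \<in> swords S" "y \<in> swords S"
  shows "special_step S R (x @ w @ y) (x @ w' @ y)"
  using assms(1) replace_factor_context[OF _ assms(2,3)]
  unfolding special_step_def type0_def type1_def type2r_def type2l_def
  by meson

lemma special_reach_context:
  assumes "special_reach S R w w'" "x \<in> swords S" "y \<in> swords S"
  shows "special_reach S R (x @ w @ y) (x @ w' @ y)"
  using assms(1) unfolding special_reach_def
proof (induction rule: rtranclp_induct)
  case (step v v')
  then show ?case
    using special_step_context[OF step(2) assms(2,3)] by (meson rtranclp.rtrancl_into_rtrancl)
qed simp

lemma special_reach_trans:
  "special_reach S R x y \<Longrightarrow> special_reach S R y z \<Longrightarrow> special_reach S R x z"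
  unfolding special_reach_def by (rule rtranclp_trans)

lemma special_step_imp_reach: "special_step S R x y \<Longrightarrow> special_reach S R x y"
  unfolding special_reach_def by (rule r_into_rtranclp)

lemma special_reach_inv_cancel:
  "a \<in> swords S \<Longrightarrow> special_reach S R (inv_word a @ a) []"
proof (induction a)
  case Nil
  then show ?case by (simp add: special_reach_def)
next
  case (Cons c a)
  have c: "c \<in> S <+> S" and a: "a \<in> swords S"
    using Cons.prems by (auto simp: swords_def)
  have "[c] \<in> swords S"
    using c by (simp add: swords_def)
  then have "replace_factor S (inv_word [c] @ [c]) [] (inv_word [c] @ [c]) []"
    by (intro replace_factor_self) auto
  then have "type0 S (inv_word [c] @ [c]) []"
    using c by (auto simp: type0_def inv_word_def)
  then have "special_step S R (inv_word [c] @ [c]) []"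
    by (simp add: special_step_def)
  then have "special_step S R (inv_word a @ (inv_word [c] @ [c]) @ a) (inv_word a @ [] @ a)"
    using a by (intro special_step_context) auto
  moreover have "inv_word (c # a) @ c # a = inv_word a @ (inv_word [c] @ [c]) @ a"
    using inv_word_append[of "[c]" a] by simp
  ultimately show ?case
    using Cons.IH[OF a] by (metis append_Nil special_step_imp_reach special_reach_trans)
qed

text \<open>
  This handles an arc containing a whole side \<open>x\<close> of the circle of a relation: once \<open>x\<close> is
  replaced by the other side \<open>acb\<close>, its two ends \<open>a\<close> and \<open>b\<close> cancel with the rest of the arc.
\<close>

lemma special_reach_cancel_ends:
  assumes "special_reach S R x (a @ c @ b)"
    and "a \<in> swords S" "b \<in> swords S" "c \<in> swords S"
  shows "special_reach S R (inv_word a @ x @ inv_word b) c"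
proof -
  have "special_reach S R (inv_word a @ x @ inv_word b)
          (inv_word a @ (a @ c @ b) @ inv_word b)"
    using assms by (intro special_reach_context) auto
  moreover have "special_reach S R ([] @ (inv_word a @ a) @ c @ b @ inv_word b)
                   ([] @ [] @ c @ b @ inv_word b)"
    using assms by (intro special_reach_context special_reach_inv_cancel) auto
  moreover have "special_reach S R (c @ (inv_word (inv_word b) @ inv_word b) @ []) (c @ [] @ [])"
    using assms by (intro special_reach_context special_reach_inv_cancel) auto
  ultimately show ?thesis
    by (auto intro: special_reach_trans)
qed

context
  fixes S :: "'a set" and R :: "('a list \<times> 'a list) set"
  assumes positive: "positive_presentation S R"
begin

lemma special_reach_relation:
  assumes "is_relation R p q"
  shows "special_reach S R (emb p) (emb q)"
    and "special_reach S R (inv_word (emb p)) (inv_word (emb q))"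
proof -
  note S = is_relation_pwords[OF positive assms]
  have "type1 S R (emb p) (emb q)" "type1 S R (inv_word (emb p)) (inv_word (emb q))"
    unfolding type1_def using S assms
    by (intro exI[of _ p] exI[of _ q]; simp add: replace_factor_self)+
  then show "special_reach S R (emb p) (emb q)"
      "special_reach S R (inv_word (emb p)) (inv_word (emb q))"
    by (simp_all add: special_step_def special_step_imp_reach)
qed

lemma special_reach_2r:
  assumes "is_relation R (v @ u) (v' @ u')" "v \<noteq> []" "v' \<noteq> []"
  shows "special_reach S R (inv_word (emb v) @ emb v') (emb u @ inv_word (emb u'))"
proof -
  have S: "v \<in> pwords S" "u \<in> pwords S" "v' \<in> pwords S" "u' \<in> pwords S"
    using is_relation_pwords[OF positive assms(1)] by auto
  then have "type2r S R (inv_word (emb v) @ emb v') (emb u @ inv_word (emb u'))"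
    unfolding type2r_def using assms
    by (intro bexI[of _ v] bexI[of _ v'] bexI[of _ u] bexI[of _ u'] conjI replace_factor_self) auto
  then show ?thesis
    by (simp add: special_step_def special_step_imp_reach)
qed

lemma special_reach_2l:
  assumes "is_relation R (u @ v) (u' @ v')" "v \<noteq> []" "v' \<noteq> []"
  shows "special_reach S R (emb v @ inv_word (emb v')) (inv_word (emb u) @ emb u')"
proof -
  have S: "v \<in> pwords S" "u \<in> pwords S" "v' \<in> pwords S" "u' \<in> pwords S"
    using is_relation_pwords[OF positive assms(1)] by auto
  then have "type2l S R (emb v @ inv_word (emb v')) (inv_word (emb u) @ emb u')"
    unfolding type2l_def using assms
    by (intro bexI[of _ v] bexI[of _ v'] bexI[of _ u] bexI[of _ u'] conjI replace_factor_self) auto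
  then show ?thesis
    by (simp add: special_step_def special_step_imp_reach)
qed


section \<open>Arcs of the circle of a relation\<close>

context
  assumes balanced: "\<And>v v'. is_relation R v v' \<Longrightarrow> \<bar>int (length v) - int (length v')\<bar> \<le> 2"
begin

text \<open>An arc contained in one side of the circle and longer than its complement is that whole side.\<close>

lemma special_reach_arc_in_side:
  assumes "is_relation R (a @ c @ b) q" "length c > length a + length q + length b"
  shows "special_reach S R (emb c) (inv_word (emb a) @ emb q @ inv_word (emb b))"
    and "special_reach S R (inv_word (emb c)) (emb b @ inv_word (emb q) @ emb a)"
proof -
  have "length a + length b = 0"
    using balanced[OF assms(1)] assms(2) unfolding length_append by linarith
  then have "a = []" "b = []"
    by auto
  then show "special_reach S R (emb c) (inv_word (emb a) @ emb q @ inv_word (emb b))"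
      "special_reach S R (inv_word (emb c)) (emb b @ inv_word (emb q) @ emb a)"
    using special_reach_relation assms(1) by simp_all
qed

text \<open>An arc with the source of the two sides in its interior or at one of its ends.\<close>

lemma special_reach_arc_over_source:
  assumes "is_relation R (v @ u) (v' @ u')" "length u + length u' < length v + length v'"
  shows "special_reach S R (inv_word (emb v) @ emb v') (emb u @ inv_word (emb u'))"
proof -
  consider "v = []" | "v' = []" | "v \<noteq> []" "v' \<noteq> []"
    by blast
  then show ?thesis
  proof cases
    case 1
    then show ?thesis
      using special_reach_arc_in_side(1)[of "[]" v' u' u] assms is_relation_sym by fastforce
  next
    case 2
    then show ?thesis
      using special_reach_arc_in_side(2)[of "[]" v u u'] assms by simp
  next
    case 3
    then show ?thesis
      using special_reach_2r assms by blast
  qed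
qed

text \<open>An arc with the target of the two sides in its interior or at one of its ends.\<close>

lemma special_reach_arc_over_target:
  assumes "is_relation R (u @ v) (u' @ v')" "length u + length u' < length v + length v'"
  shows "special_reach S R (emb v @ inv_word (emb v')) (inv_word (emb u) @ emb u')"
proof -
  consider "v = []" | "v' = []" | "v \<noteq> []" "v' \<noteq> []"
    by blast
  then show ?thesis
  proof cases
    case 1
    then show ?thesis
      using special_reach_arc_in_side(2)[of u' v' "[]" u] assms is_relation_sym by fastforce
  next
    case 2
    then show ?thesis
      using special_reach_arc_in_side(1)[of u v "[]" u'] assms by simp
  next
    case 3
    then show ?thesis
      using special_reach_2l assms by blast
  qed
qed

text \<open>
  In the proof, \<open>u\<inverse>\<close> is followed around the circle from its starting point, which gives six
  cases; the lemmas above treat each of them.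
\<close>

lemma special_reach_complementary_arc:
  assumes rel: "is_relation R p q"
    and cyc: "cyclic_perm (inv_word u @ u') (inv_word (emb p) @ emb q)"
    and len: "length u' < length u"
  shows "special_reach S R u u'"
proof -
  note S = is_relation_pwords[OF positive rel]
  obtain A B where AB: "inv_word (emb p) @ emb q = A @ B" and BA: "inv_word u @ u' = B @ A"
    using cyc unfolding cyclic_perm_def by (metis append_take_drop_id rotate_drop_take)
  \<comment> \<open>The starting point of the arc \<open>u\<inverse>\<close>, which separates \<open>A\<close> from \<open>B\<close>, lies on \<open>p\<close> or on \<open>q\<close>.\<close>
  from AB consider (p) C where "inv_word (emb p) = A @ C" "B = C @ emb q"
    | (q) C where "A = inv_word (emb p) @ C" "emb q = C @ B"
    by (auto simp: append_eq_append_conv2)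
  then show ?thesis
  proof cases
    case p
    obtain c a where pc: "p = c @ a" "A = inv_word (emb a)" "C = inv_word (emb c)"
      using p(1) by (auto simp: inv_word_emb_eq_append_conv)
    have eq: "inv_word u @ u' = C @ emb q @ A"
      using BA p(2) by simp
    \<comment> \<open>The arc \<open>u\<inverse>\<close> ends before leaving \<open>p\<close>, on \<open>q\<close>, or again on \<open>p\<close>.\<close>
    then consider (1) D where "C = inv_word u @ D" "u' = D @ emb q @ A"
      | (2) D E where "inv_word u = C @ D" "D @ E = emb q" "u' = E @ A"
      | (3) D where "inv_word u = C @ emb q @ D" "A = D @ u'"
      by (auto simp: append_eq_append_conv2)
    then show ?thesis
    proof cases
      case 1
      obtain d w where dw: "c = d @ w" "D = inv_word (emb d)" "inv_word u = inv_word (emb w)"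
        using 1(1) pc(3) by (auto simp: inv_word_emb_eq_append_conv)
      then have "u = emb w"
        by (metis inv_word_inv_word)
      then show ?thesis
        using special_reach_arc_in_side(1)[of d w a q] rel len 1 dw pc by simp
    next
      case 2
      obtain d e where de: "q = d @ e" "D = emb d" "E = emb e"
        using 2(2)[symmetric] by (auto simp: emb_eq_append_conv)
      have "u = inv_word (emb d) @ emb c"
        using 2(1) de pc by (simp add: inv_word_eq_iff)
      then show ?thesis
        using special_reach_arc_over_source[of d e c a] is_relation_sym[OF rel] len 2 de pc by simp
    next
      case 3
      have "u = inv_word D @ inv_word (emb q) @ inv_word C"
        using 3(1) by (simp add: inv_word_eq_iff)
      moreover have "special_reach S R (inv_word (emb q)) (D @ u' @ C)"
        using special_reach_relation(2)[OF is_relation_sym[OF rel]] p(1) 3(2) by simp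
      moreover have "D \<in> swords S" "u' \<in> swords S" "C \<in> swords S"
        using S p(1) 3(2) inv_word_swords[of "emb p" S] by auto
      ultimately show ?thesis
        using special_reach_cancel_ends by blast
    qed
  next
    case q
    obtain c b where qc: "q = c @ b" "C = emb c" "B = emb b"
      using q(2) by (auto simp: emb_eq_append_conv)
    have eq: "inv_word u @ u' = B @ inv_word (emb p) @ C"
      using BA q(1) by simp
    \<comment> \<open>The arc \<open>u\<inverse>\<close> ends before leaving \<open>q\<close>, on \<open>p\<close>, or again on \<open>q\<close>.\<close>
    then consider (1) D where "B = inv_word u @ D" "u' = D @ inv_word (emb p) @ C"
      | (2) D E where "inv_word u = B @ D" "D @ E = inv_word (emb p)" "u' = E @ C"
      | (3) D where "inv_word u = B @ inv_word (emb p) @ D" "C = D @ u'"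
      by (auto simp: append_eq_append_conv2)
    then show ?thesis
    proof cases
      case 1
      obtain w d where dw: "b = w @ d" "D = emb d" "inv_word u = emb w"
        using 1(1) qc(3) by (auto simp: emb_eq_append_conv)
      then have "u = inv_word (emb w)"
        by (metis inv_word_inv_word)
      then show ?thesis
        using special_reach_arc_in_side(2)[of c w d p] is_relation_sym[OF rel] len 1 dw qc by simp
    next
      case 2
      obtain e d where de: "p = e @ d" "D = inv_word (emb d)" "E = inv_word (emb e)"
        using 2(2)[symmetric] by (auto simp: inv_word_emb_eq_append_conv)
      have "u = emb d @ inv_word (emb b)"
        using 2(1) de qc by (simp add: inv_word_eq_iff)
      then show ?thesis
        using special_reach_arc_over_target[of e d c b] rel len 2 de qc by simp
    next
      case 3
      have "u = inv_word D @ emb p @ inv_word B"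
        using 3(1) by (simp add: inv_word_eq_iff)
      moreover have "special_reach S R (emb p) (D @ u' @ B)"
        using special_reach_relation(1)[OF rel] q(2) 3(2) by simp
      moreover have "D \<in> swords S" "u' \<in> swords S" "B \<in> swords S"
        using S q(2) 3(2) emb_swords[of q S] by auto
      ultimately show ?thesis
        using special_reach_cancel_ends by blast
    qed
  qed
qed

lemma dehn_step_imp_special_reach:
  assumes "dehn_step S R w w'"
  shows "special_reach S R w w'"
proof -
  obtain u u' v v' where rf: "replace_factor S u u' w w'" and len: "length u' < length u"
    and rel: "is_relation R v v'"
    and cyc: "cyclic_perm (inv_word u @ u') (inv_word (emb v) @ emb v') \<or>
              cyclic_perm (inv_word u @ u') (inv_word (emb v') @ emb v)"
    using assms unfolding dehn_step_def by blast
  have "special_reach S R u u'"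
    using cyc special_reach_complementary_arc rel is_relation_sym[OF rel] len by blast
  then show ?thesis
    using rf special_reach_context unfolding replace_factor_def by blast
qed

end

end


section \<open>Dehn reductions are special\<close>

theorem proposition1p8:
  fixes S :: "'a set" and R :: "('a list \<times> 'a list) set"
  assumes "positive_presentation S R"
    and "\<And>v v'. is_relation R v v' \<Longrightarrow> \<bar>int (length v) - int (length v')\<bar> \<le> 2"
  shows "\<forall>w \<in> swords S. \<forall>w' \<in> swords S. dehn_reach S R w w' \<longrightarrow> special_reach S R w w'"
proof -
  have dehn_imp_reach: "special_reach S R x y" if "type0 S x y \<or> dehn_step S R x y" for x y
    using that dehn_step_imp_special_reach[OF assms]
    by (auto simp: special_step_def intro: special_step_imp_reach)
  have "special_reach S R w w'" if "dehn_reach S R w w'" for w w'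
    using that unfolding dehn_reach_def
  proof (induction rule: rtranclp_induct)
    case base
    show ?case by (simp add: special_reach_def)
  next
    case (step y z)
    then show ?case
      using special_reach_trans[OF step.IH] dehn_imp_reach by blast
  qed
  then show ?thesis
    by blast
qed

end
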